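(* Let $\beta<0$, $\kappa>0$ and $K\neq0$ be real constants and let $I=\{r>0:1-Kr>0\}$. Set $\mathcal{A}(\psi)\equiv1$, $\tilde{\mathcal{C}}(\psi)=\sqrt{-\tfrac{2\beta}{3}}\,\psi$, $\mathcal{V}\equiv0$, and $$A(r)=1-Kr,\qquad C(r)=1,\qquad \psi(r)=\sqrt{-\tfrac{6}{\beta}}\,\log(1-Kr).$$ Then $E^{(1)}_{tt}=E^{(1)}_{rr}=E^{(1)}_{\vartheta\vartheta}=E^{(1)}_{\psi}=0$ hold on $I$, i.e. this is a solution of the real-tetrad vacuum field equations with metric ${\rm d}s^2=(1-Kr)^2{\rm d}t^2-(1-Kr)^{-2}{\rm d}r^2-r^2{\rm d}\Omega^2$.
   Context: Metric ansatz ${\rm d}s^2=A(r)^2{\rm d}t^2-\frac{C(r)^2}{A(r)^2}{\rm d}r^2-r^2{\rm d}\Omega^2$, $\psi=\psi(r)$. Primes on $A,C,\psi$ are $r$-derivatives; $\mathcal{A}',\tilde{\mathcal{C}}',\tilde{\mathcal{C}}'',\mathcal{V}'$ are $\psi$-derivatives evaluated at $\psi(r)$. The real-tetrad reduced vacuum field equations of the scalar-torsion theory are: $E^{(1)}_{tt}:\ 0=\mathcal{A}\frac{A^2(-2rACA'-A^2(C-2rC')+C^3)}{r^2C^3}+\tilde{\mathcal{C}}'\Big(\frac{A^4\psi''}{C^2}-\frac{A^3\psi'(-rCA'+rAC'-2C^2)}{rC^3}\Big)-\frac{2A^3(A-C)\psi'\mathcal{A}'}{rC^2}+\frac{A^4\psi'^2\tilde{\mathcal{C}}''}{C^2}-\frac{\beta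 A^4\psi'^2}{2C^2}+\kappa^2A^2\mathcal{V}$; $E^{(1)}_{rr}:\ 0=-\frac{(2rAA'+A^2-C^2)\mathcal{A}}{r^2A^2}+\big(\frac{A'}{A}+\frac2r\big)\psi'\tilde{\mathcal{C}}'+\frac{\kappa^2C^2\mathcal{V}}{A^2}+\frac12\beta\psi'^2$; $E^{(1)}_{\vartheta\vartheta}:\ 0=-\frac{A\psi'(rA'+A-C)\mathcal{A}'}{rC^2}+\tilde{\mathcal{C}}'\Big(\frac{A\psi'(rCA'-rAC'+C^2)}{rC^3}+\frac{A^2\psi''}{C^2}\Big)+\frac{\mathcal{A}(-rCA'^2+A(rA'C'-C(rA''+2A'))+A^2C')}{rC^3}+\frac{A^2\psi'^2\tilde{\mathcal{C}}''}{C^2}-\frac{\beta A^2\psi'^2}{2C^2}+\kappa^2\mathcal{V}$; $E^{(1)}_{\psi}:\ 0=\frac{(A-C)(2rA'+A-C)\mathcal{A}'}{r^2C^2}+\frac{\beta A\psi'(2rCA'+A(2C-rC'))}{rC^3}+\frac{\beta A^2\psi''}{C^2}+\kappa^2\mathcal{V}'+\frac{\tilde{\mathcal{C}}'(rCA'(rA'-2C)+A(-r^2A'C'+rC(rA''+6A')-2C^2)+2A^2(C-rC'))}{r^2C^3}$. *)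

theory Defs
  imports "HOL-Analysis.Analysis"
begin

text \<open>Reduced real-tetrad vacuum field equations of the scalar-torsion theory,
for metric functions A, C, scalar field psi (functions of r) and coupling
functions calA, Ct (= C-tilde), V (functions of psi).
Each definition gives the right-hand side of the equation "0 = ...".\<close>

definition E_tt ::
  "real \<Rightarrow> real \<Rightarrow> (real \<Rightarrow> real) \<Rightarrow> (real \<Rightarrow> real) \<Rightarrow> (real \<Rightarrow> real) \<Rightarrow>
   (real \<Rightarrow> real) \<Rightarrow> (real \<Rightarrow> real) \<Rightarrow> (real \<Rightarrow> real) \<Rightarrow> real \<Rightarrow> real" where
  "E_tt \<beta> \<kappa> calA Ct V A C \<psi> r =
    (let a = A r; a1 = deriv A r; c = C r; c1 = deriv C r;
         p = \<psi> r; p1 = deriv \<psi> r; p2 = deriv (deriv \<psi>) r;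
         F = calA p; F1 = deriv calA p; G1 = deriv Ct p; G2 = deriv (deriv Ct) p; W = V p
     in F * (a^2 * (-2*r*a*c*a1 - a^2*(c - 2*r*c1) + c^3)) / (r^2 * c^3)
        + G1 * (a^4 * p2 / c^2 - a^3 * p1 * (-r*c*a1 + r*a*c1 - 2*c^2) / (r * c^3))
        - 2 * a^3 * (a - c) * p1 * F1 / (r * c^2)
        + a^4 * p1^2 * G2 / c^2
        - \<beta> * a^4 * p1^2 / (2 * c^2)
        + \<kappa>^2 * a^2 * W)"

definition E_rr ::
  "real \<Rightarrow> real \<Rightarrow> (real \<Rightarrow> real) \<Rightarrow> (real \<Rightarrow> real) \<Rightarrow> (real \<Rightarrow> real) \<Rightarrow>
   (real \<Rightarrow> real) \<Rightarrow> (real \<Rightarrow> real) \<Rightarrow> (real \<Rightarrow> real) \<Rightarrow> real \<Rightarrow> real" where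
  "E_rr \<beta> \<kappa> calA Ct V A C \<psi> r =
    (let a = A r; a1 = deriv A r; c = C r;
         p = \<psi> r; p1 = deriv \<psi> r;
         F = calA p; G1 = deriv Ct p; W = V p
     in - ((2*r*a*a1 + a^2 - c^2) * F) / (r^2 * a^2)
        + (a1 / a + 2 / r) * p1 * G1
        + \<kappa>^2 * c^2 * W / a^2
        + 1/2 * \<beta> * p1^2)"

definition E_thth ::
  "real \<Rightarrow> real \<Rightarrow> (real \<Rightarrow> real) \<Rightarrow> (real \<Rightarrow> real) \<Rightarrow> (real \<Rightarrow> real) \<Rightarrow>
   (real \<Rightarrow> real) \<Rightarrow> (real \<Rightarrow> real) \<Rightarrow> (real \<Rightarrow> real) \<Rightarrow> real \<Rightarrow> real" where
  "E_thth \<beta> \<kappa> calA Ct V A C \<psi> r =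
    (let a = A r; a1 = deriv A r; a2 = deriv (deriv A) r; c = C r; c1 = deriv C r;
         p = \<psi> r; p1 = deriv \<psi> r; p2 = deriv (deriv \<psi>) r;
         F = calA p; F1 = deriv calA p; G1 = deriv Ct p; G2 = deriv (deriv Ct) p; W = V p
     in - a * p1 * (r*a1 + a - c) * F1 / (r * c^2)
        + G1 * (a * p1 * (r*c*a1 - r*a*c1 + c^2) / (r * c^3) + a^2 * p2 / c^2)
        + F * (-r*c*a1^2 + a*(r*a1*c1 - c*(r*a2 + 2*a1)) + a^2*c1) / (r * c^3)
        + a^2 * p1^2 * G2 / c^2
        - \<beta> * a^2 * p1^2 / (2 * c^2)
        + \<kappa>^2 * W)"

definition E_psi ::
  "real \<Rightarrow> real \<Rightarrow> (real \<Rightarrow> real) \<Rightarrow> (real \<Rightarrow> real) \<Rightarrow> (real \<Rightarrow> real) \<Rightarrow>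
   (real \<Rightarrow> real) \<Rightarrow> (real \<Rightarrow> real) \<Rightarrow> (real \<Rightarrow> real) \<Rightarrow> real \<Rightarrow> real" where
  "E_psi \<beta> \<kappa> calA Ct V A C \<psi> r =
    (let a = A r; a1 = deriv A r; a2 = deriv (deriv A) r; c = C r; c1 = deriv C r;
         p = \<psi> r; p1 = deriv \<psi> r; p2 = deriv (deriv \<psi>) r;
         F1 = deriv calA p; G1 = deriv Ct p; W1 = deriv V p
     in (a - c) * (2*r*a1 + a - c) * F1 / (r^2 * c^2)
        + \<beta> * a * p1 * (2*r*c*a1 + a*(2*c - r*c1)) / (r * c^3)
        + \<beta> * a^2 * p2 / c^2
        + \<kappa>^2 * W1
        + G1 * (r*c*a1*(r*a1 - 2*c) + a*(- (r^2*a1*c1) + r*c*(r*a2 + 6*a1) - 2*c^2)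
                + 2*a^2*(c - r*c1)) / (r^2 * c^3))"

end

theory Submission
  imports Defs
begin

text \<open>With \<open>a = 1 - K r\<close> the scalar field satisfies \<open>a \<psi>' = -s K\<close> and \<open>a\<^sup>2 \<psi>'' = -s K\<^sup>2\<close>,
so the two coupling relations \<open>\<beta> s\<^sup>2 = -6\<close> and \<open>s g = 2\<close> turn every field equation into a
polynomial identity in \<open>a\<close>, \<open>K\<close>, \<open>r\<close>, which then holds because \<open>a + K r = 1\<close>.\<close>

lemma coupling_constants:
  fixes \<beta> :: real
  assumes "\<beta> < 0"
  shows "\<beta> * sqrt (- 6 / \<beta>)^2 = - 6" and "sqrt (- 6 / \<beta>) * sqrt (- 2 * \<beta> / 3) = 2"
proof -
  show "\<beta> * sqrt (- 6 / \<beta>)^2 = - 6"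
    using assms by (simp add: divide_neg_neg less_imp_le)
  have "sqrt (- 6 / \<beta>) * sqrt (- 2 * \<beta> / 3) = sqrt ((- 6 / \<beta>) * (- 2 * \<beta> / 3))"
    by (rule real_sqrt_mult[symmetric])
  also have "(- 6 / \<beta>) * (- 2 * \<beta> / 3) = 4"
    using assms by (simp add: field_simps)
  finally show "sqrt (- 6 / \<beta>) * sqrt (- 2 * \<beta> / 3) = 2" by simp
qed

lemma deriv_linear: "deriv (\<lambda>x. c * x) = (\<lambda>_. c :: real)"
  by (rule ext, rule DERIV_imp_deriv) (auto intro!: derivative_eq_intros)

lemma deriv_affine: "deriv (\<lambda>x. 1 - K * x) = (\<lambda>_. - K :: real)"
  by (rule ext, rule DERIV_imp_deriv) (auto intro!: derivative_eq_intros)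

lemma has_real_derivative_scaled_ln_affine:
  fixes s K x :: real
  assumes "0 < 1 - K * x"
  shows "((\<lambda>r. s * ln (1 - K * r)) has_real_derivative - s * K / (1 - K * x)) (at x)"
  using assms by (auto intro!: derivative_eq_intros simp: field_simps)

lemma deriv_scaled_ln_affine:
  fixes s K x :: real
  assumes "0 < 1 - K * x"
  shows "deriv (\<lambda>r. s * ln (1 - K * r)) x = - s * K / (1 - K * x)"
  using has_real_derivative_scaled_ln_affine[OF assms] by (rule DERIV_imp_deriv)

lemma deriv2_scaled_ln_affine:
  fixes s K x :: real
  assumes "0 < 1 - K * x"
  shows "deriv (deriv (\<lambda>r. s * ln (1 - K * r))) x = - s * K^2 / (1 - K * x)^2"
proof (rule DERIV_imp_deriv)
  have "((\<lambda>r. - s * K / (1 - K * r)) has_real_derivative - s * K^2 / (1 - K * x)^2) (at x)"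
    using assms by (auto intro!: derivative_eq_intros simp: field_simps power2_eq_square)
  then show "(deriv (\<lambda>r. s * ln (1 - K * r)) has_real_derivative - s * K^2 / (1 - K * x)^2) (at x)"
  proof (rule has_field_derivative_transform_within_open)
    show "open {y. 0 < 1 - K * y}"
      by (auto intro!: open_Collect_less continuous_intros)
  qed (use assms deriv_scaled_ln_affine in auto)
qed

lemma log_profile_solves_field_equations:
  fixes \<beta> \<kappa> K s g r :: real
  assumes beta_s: "\<beta> * s^2 = - 6" and s_g: "s * g = 2"
    and r_pos: "0 < r" and a_pos: "0 < 1 - K * r"
  defines "calA \<equiv> \<lambda>_. 1" and "Ct \<equiv> \<lambda>x. g * x" and "V \<equiv> \<lambda>_. 0"
    and "A \<equiv> \<lambda>x. 1 - K * x" and "C \<equiv> \<lambda>_. 1" and "\<psi> \<equiv> \<lambda>x. s * ln (1 - K * x)"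
  shows "E_tt \<beta> \<kappa> calA Ct V A C \<psi> r = 0 \<and> E_rr \<beta> \<kappa> calA Ct V A C \<psi> r = 0 \<and>
    E_thth \<beta> \<kappa> calA Ct V A C \<psi> r = 0 \<and> E_psi \<beta> \<kappa> calA Ct V A C \<psi> r = 0"
proof -
  \<comment> \<open>naming \<open>1 - K r\<close> keeps the simplifier from rewriting \<open>1 - K r \<noteq> 0\<close> into a form
    \<open>field_simps\<close> cannot use when clearing denominators\<close>
  define a where "a = 1 - K * r"
  have "a \<noteq> 0" "r \<noteq> 0" "K * r = 1 - a"
    using a_pos r_pos by (auto simp: a_def)
  note ansatz_derivs = deriv_const deriv_linear deriv_affine
    deriv_scaled_ln_affine[OF a_pos] deriv2_scaled_ln_affine[OF a_pos]
  show ?thesis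
    using \<open>a \<noteq> 0\<close> \<open>r \<noteq> 0\<close> \<open>K * r = 1 - a\<close> beta_s s_g
    unfolding E_tt_def E_rr_def E_thth_def E_psi_def Let_def calA_def Ct_def V_def A_def C_def \<psi>_def
    by (simp only: ansatz_derivs a_def[symmetric]) (intro conjI; simp add: field_simps; algebra)
qed

theorem mainTheorem3:
  fixes \<beta> \<kappa> K :: real
  assumes "\<beta> < 0" and "\<kappa> > 0" and "K \<noteq> 0"
  defines "calA \<equiv> (\<lambda>_::real. 1::real)"
      and "Ct \<equiv> (\<lambda>x::real. sqrt (- 2 * \<beta> / 3) * x)"
      and "V \<equiv> (\<lambda>_::real. 0::real)"
      and "A \<equiv> (\<lambda>r::real. 1 - K * r)"
      and "C \<equiv> (\<lambda>_::real. 1::real)"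
      and "\<psi> \<equiv> (\<lambda>r::real. sqrt (- 6 / \<beta>) * ln (1 - K * r))"
  shows "\<forall>r \<in> {r. 0 < r \<and> 0 < 1 - K * r}.
           E_tt \<beta> \<kappa> calA Ct V A C \<psi> r = 0 \<and>
           E_rr \<beta> \<kappa> calA Ct V A C \<psi> r = 0 \<and>
           E_thth \<beta> \<kappa> calA Ct V A C \<psi> r = 0 \<and>
           E_psi \<beta> \<kappa> calA Ct V A C \<psi> r = 0"
  unfolding calA_def Ct_def V_def A_def C_def \<psi>_def
  using coupling_constants[OF \<open>\<beta> < 0\<close>]
  by (intro ballI log_profile_solves_field_equations) auto

end
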